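(* Let $K$ be a $k$-algebra that is weak distributive and left alternative, equipped with a conjugation such that the trace is $k$-valued and the norm is anisotropic and $k$-valued. If $K$ has a nonzero imaginary element, then an element $a \in K$ satisfies $n(a)=1$ if and only if there is a nonzero $b \in K$ satisfying $\overline{b}a=b$.
   Context: Let $k$ be a field. A $k$-algebra $K$ (not assumed commutative, associative or distributive) is a left $k$-vector space equipped with a multiplication and a multiplicative identity $1$ such that: $k$ is a subset of the center of $K$ (elements of $k$ commute with all elements of $K$), and the additive and multiplicative structure on $k$ is the restriction of that on $K$; and $a(bc)=(ab)c$ for $a,b,c\in K$ whenever at least one of $a,b,c$ belongs to $k$. $K$ is weak right distributive if $(a+b)c=ac+bc$ for all $a\in k$, $b,c\in K$; weak left distributive if $c(a+b)=ca+cb$ for all $a\in k$, $b,c\in K$; weak distributive if both hold. $K$ is left alternative if $a(ab)=a^2b$ for all $a,b\in K$. A conjugation on $K$ is a self-inverse $k$-linear map $\overline{\phantom{a}}:K\to K$ restricting to the identity on $k$. The norm and trace $n,t:K\to K$ are $n(a)=\overline{a}a$ and $t(a)=a+\overline{a}$. They are called $k$-valued if their values lie in $k$. An element $a$ is imaginary if $t(a)=0$. The norm is anisotropic if $n(a)\neq 0$ for all nonzero $a\in K$. *)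

theory Defs
  imports Complex_Main
begin

text \<open>
  The field is a type \<open>'k\<close>, the algebra a type \<open>'a\<close> whose \<open>times\<close> and \<open>one\<close> carry no class axioms,
  since neither associativity nor distributivity is available.  The inclusion of the field into
  the algebra is \<open>c \<mapsto> c \<cdot> 1\<close>, as for \<^const>\<open>of_real\<close>.
\<close>

definition emb :: "('k::field \<Rightarrow> 'a::{ab_group_add, times, one} \<Rightarrow> 'a) \<Rightarrow> 'k \<Rightarrow> 'a" where
  "emb scale c = scale c 1"

text \<open>
  The juxtaposition \<open>cx\<close> of a scalar and an element is both the vector space action and the product
  in the algebra; \<open>scale_eq_mult\<close> says that the two agree.  Some of the axioms are redundant.
\<close>

locale k_algebra = vector_space scale
  for scale :: "'k::field \<Rightarrow> 'a::{ab_group_add, times, one} \<Rightarrow> 'a" +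
  assumes one_mult: "1 * x = (x :: 'a)"
    and mult_one: "x * 1 = (x :: 'a)"
    and emb_inj: "inj (emb scale)"
    and emb_add: "emb scale (c + d) = emb scale c + emb scale d"
    and emb_mult: "emb scale (c * d) = emb scale c * emb scale d"
    and emb_one: "emb scale 1 = 1"
    and scale_eq_mult: "scale c x = emb scale c * x"
    and emb_central: "emb scale c * x = x * emb scale c"
    and assoc_left: "emb scale c * (x * y) = (emb scale c * x) * y"
    and assoc_middle: "x * (emb scale c * y) = (x * emb scale c) * y"
    and assoc_right: "x * (y * emb scale c) = (x * y) * emb scale c"

definition weak_right_distributive ::
    "('k::field \<Rightarrow> 'a::{ab_group_add, times, one} \<Rightarrow> 'a) \<Rightarrow> bool" where
  "weak_right_distributive scale \<longleftrightarrow>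
     (\<forall>a \<in> range (emb scale). \<forall>b c. (a + b) * c = a * c + b * c)"

definition weak_left_distributive ::
    "('k::field \<Rightarrow> 'a::{ab_group_add, times, one} \<Rightarrow> 'a) \<Rightarrow> bool" where
  "weak_left_distributive scale \<longleftrightarrow>
     (\<forall>a \<in> range (emb scale). \<forall>b c. c * (a + b) = c * a + c * b)"

definition weak_distributive ::
    "('k::field \<Rightarrow> 'a::{ab_group_add, times, one} \<Rightarrow> 'a) \<Rightarrow> bool" where
  "weak_distributive scale \<longleftrightarrow> weak_right_distributive scale \<and> weak_left_distributive scale"

definition left_alternative :: "'a::times itself \<Rightarrow> bool" where
  "left_alternative _ \<longleftrightarrow> (\<forall>a b :: 'a. a * (a * b) = (a * a) * b)"

definition conjugation ::
    "('k::field \<Rightarrow> 'a::{ab_group_add, times, one} \<Rightarrow> 'a) \<Rightarrow> ('a \<Rightarrow> 'a) \<Rightarrow> bool" where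
  "conjugation scale bar \<longleftrightarrow>
     Vector_Spaces.linear scale scale bar \<and>
     (\<forall>x. bar (bar x) = x) \<and>
     (\<forall>c. bar (emb scale c) = emb scale c)"

definition conj_norm :: "('a::times \<Rightarrow> 'a) \<Rightarrow> 'a \<Rightarrow> 'a" where
  "conj_norm bar a = bar a * a"

definition conj_trace :: "('a::plus \<Rightarrow> 'a) \<Rightarrow> 'a \<Rightarrow> 'a" where
  "conj_trace bar a = a + bar a"

definition k_valued ::
    "('k::field \<Rightarrow> 'a::{ab_group_add, times, one} \<Rightarrow> 'a) \<Rightarrow> ('a \<Rightarrow> 'a) \<Rightarrow> bool" where
  "k_valued scale f \<longleftrightarrow> range f \<subseteq> range (emb scale)"

definition imaginary :: "('a::{plus, zero} \<Rightarrow> 'a) \<Rightarrow> 'a \<Rightarrow> bool" where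
  "imaginary bar a \<longleftrightarrow> conj_trace bar a = 0"

definition anisotropic :: "('a::zero \<Rightarrow> 'a) \<Rightarrow> bool" where
  "anisotropic n \<longleftrightarrow> (\<forall>a. a \<noteq> 0 \<longrightarrow> n a \<noteq> 0)"

end

theory Submission imports Defs begin

text \<open>
  Since \<open>bar x\<close> is a scalar minus \<open>x\<close>, every \<open>x\<close> satisfies \<open>x\<^sup>2 = t(x)x - n(x)\<close>; with left
  alternativity this gives \<open>bar x (x y) = n(x) y = x (bar x y)\<close> and \<open>n(x\<^sup>2) = n(x)\<^sup>2\<close>.
  If \<open>bar b a = b\<close>, multiplying by \<open>b\<close> on the left gives \<open>n(b) a = b\<^sup>2\<close>, and taking norms yields
  \<open>n(a) = 1\<close>.  Conversely, if \<open>n(a) = 1\<close> then \<open>b = 1 + a\<close> works unless \<open>a = -1\<close>, in which case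
  any nonzero imaginary \<open>b\<close> does.
\<close>

context k_algebra
begin

lemma scale_mult: "scale c x * y = scale c (x * y)"
  by (simp add: scale_eq_mult assoc_left)

lemma mult_scale: "x * scale c y = scale c (x * y)"
  by (metis assoc_left assoc_middle emb_central scale_eq_mult)

text \<open>Only sums with a scalar summand distribute, so the sign rule is drawn from the scalar
  action of \<open>- 1\<close>.\<close>

lemma minus_mult: "(- x) * y = (- (x * y) :: 'a)"
  using scale_mult[of "- 1" x y] by simp

lemma mult_emb: "x * emb scale c = scale c x"
  by (simp add: scale_eq_mult emb_central)

lemma mult_minus_one: "x * (- 1) = (- x :: 'a)"
  using mult_emb[of x "- 1"] by (simp add: emb_def)

lemma scale_emb: "scale c (emb scale d) = emb scale (c * d)"
  by (simp add: emb_def)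

end

locale conj_algebra = k_algebra scale
  for scale :: "'k::field \<Rightarrow> 'a::{ab_group_add, times, one} \<Rightarrow> 'a" +
  fixes bar :: "'a \<Rightarrow> 'a"
  assumes weak_distrib: "weak_distributive scale"
    and left_alt: "left_alternative TYPE('a)"
    and conj_bar: "conjugation scale bar"
    and trace_scalar: "k_valued scale (conj_trace bar)"
    and norm_scalar: "k_valued scale (conj_norm bar)"
begin

sublocale bar: Vector_Spaces.linear scale scale bar
  using conj_bar by (simp add: conjugation_def)

lemma bar_bar: "bar (bar x) = x"
  and bar_emb: "bar (emb scale c) = emb scale c"
  using conj_bar by (simp_all add: conjugation_def)

lemma bar_one: "bar 1 = 1"
  using bar_emb[of 1] by (simp only: emb_one)

lemma mult_left_alt: "x * (x * y) = (x * x) * (y :: 'a)"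
  using left_alt by (simp add: left_alternative_def)

lemma emb_add_mult: "(emb scale c + x) * y = scale c y + x * y"
  using weak_distrib
  by (simp add: weak_distributive_def weak_right_distributive_def scale_eq_mult)

lemma mult_emb_add: "y * (emb scale c + x) = scale c y + y * x"
  using weak_distrib
  by (simp add: weak_distributive_def weak_left_distributive_def mult_emb)

lemma emb_diff_mult: "(emb scale c - x) * y = scale c y - x * y"
  using emb_add_mult[of c "- x" y] by (simp add: minus_mult)

lemma obtain_norm:
  obtains n where "bar x * x = emb scale n"
  using norm_scalar by (auto simp: k_valued_def conj_norm_def)

lemma obtain_trace:
  obtains t where "bar x = emb scale t - x"
proof -
  obtain t where "x + bar x = emb scale t"
    using trace_scalar by (auto simp: k_valued_def conj_trace_def)
  then have "bar x = emb scale t - x"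
    by (metis add_diff_cancel_left')
  then show thesis by (rule that)
qed

lemma square_eq:
  assumes "bar x = emb scale t - x" "bar x * x = emb scale n"
  shows "x * x = scale t x - emb scale n"
proof -
  have "emb scale n = scale t x - x * x"
    using emb_diff_mult[of t x x] assms by simp
  then show ?thesis
    by (simp add: algebra_simps)
qed

lemma bar_mult_cancel:
  assumes n: "bar x * x = emb scale n"
  shows "bar x * (x * y) = scale n y"
proof -
  obtain t where t: "bar x = emb scale t - x" by (rule obtain_trace)
  \<comment> \<open>The scalar summand is isolated so that weak right distributivity expands
    \<open>(x * x) * y\<close>; left alternativity then matches this with
    \<open>x * (x * y)\<close>.\<close>
  have "x * x = emb scale (- n) + scale t x"
    using square_eq[OF t n] by (simp add: emb_def)
  then have "(x * x) * y = scale t (x * y) - scale n y"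
    by (simp add: emb_add_mult scale_mult)
  then show ?thesis
    by (simp add: t emb_diff_mult mult_left_alt)
qed

text \<open>Weak left distributivity enters here: expanding \<open>x * (t - x)\<close> gives
  \<open>t x - x * x\<close>, just as expanding on the other side does.\<close>

lemma mult_bar_eq:
  assumes n: "bar x * x = emb scale n"
  shows "x * bar x = emb scale n"
proof -
  obtain t where t: "bar x = emb scale t - x" by (rule obtain_trace)
  have "x * bar x = scale t x + x * (- x)"
    using mult_emb_add[of x t "- x"] by (simp add: t)
  also have "x * (- x) = - (x * x)"
    using mult_scale[of x "- 1" x] by simp
  finally show ?thesis
    by (simp add: square_eq[OF t n])
qed

lemma mult_bar_cancel:
  assumes "bar x * x = emb scale n"
  shows "x * (bar x * y) = scale n y"
  using bar_mult_cancel[of "bar x" n y] mult_bar_eq[OF assms] by (simp add: bar_bar)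

text \<open>No product rule for \<open>bar\<close> is assumed. Instead, \<open>x\<close> and
  \<open>bar x\<close> share trace and norm, hence satisfy the same quadratic equation, and
  \<open>bar\<close> is linear and fixes scalars.\<close>

lemma bar_square: "bar (x * x) = bar x * bar x"
proof -
  obtain t where t: "bar x = emb scale t - x" by (rule obtain_trace)
  obtain n where n: "bar x * x = emb scale n" by (rule obtain_norm)
  have "bar (bar x) = emb scale t - bar x"
    unfolding bar_bar by (simp add: t)
  moreover have "bar (bar x) * bar x = emb scale n"
    by (simp add: bar_bar mult_bar_eq[OF n])
  ultimately have "bar x * bar x = scale t (bar x) - emb scale n"
    by (rule square_eq)
  then show ?thesis
    by (simp add: square_eq[OF t n] bar.diff bar.scale bar_emb)
qed

lemma norm_square:
  assumes n: "bar x * x = emb scale n"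
  shows "bar (x * x) * (x * x) = emb scale (n * n)"
proof -
  \<comment> \<open>Left alternativity for \<open>bar x\<close> regroups the product so that one
    factor \<open>bar x\<close> cancels against \<open>x * x\<close>.\<close>
  have "bar (x * x) * (x * x) = bar x * (bar x * (x * x))"
    by (simp add: bar_square mult_left_alt)
  also have "\<dots> = scale n (bar x * x)"
    by (simp add: bar_mult_cancel[OF n] mult_scale)
  finally show ?thesis
    by (simp add: n scale_emb)
qed

lemma norm_scale: "bar (scale c x) * scale c x = scale (c * c) (bar x * x)"
  by (simp add: bar.scale scale_mult mult_scale)

lemma norm_eq_one_if_bar_mult_eq:
  assumes aniso: "anisotropic (conj_norm bar)" and "b \<noteq> 0" and eq: "bar b * a = b"
  shows "bar a * a = 1"
proof -
  obtain n where n: "bar b * b = emb scale n" by (rule obtain_norm)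
  have "bar b * b \<noteq> 0"
    using aniso \<open>b \<noteq> 0\<close> by (simp add: anisotropic_def conj_norm_def)
  then have "n \<noteq> 0"
    unfolding n emb_def by auto
  \<comment> \<open>This is \<open>b * (bar b * a)\<close> evaluated in two ways: by cancellation
    and by \<open>eq\<close>.\<close>
  have square: "scale n a = b * b"
    using mult_bar_cancel[OF n, of a] unfolding eq by (rule sym)
  \<comment> \<open>Both sides of \<open>square\<close> are compared by norm; the common factor
    \<open>n * n\<close> is nonzero by anisotropy.\<close>
  have "scale (n * n) (bar a * a) = bar (b * b) * (b * b)"
    unfolding norm_scale[symmetric] square ..
  also have "\<dots> = scale (n * n) 1"
    unfolding norm_square[OF n] emb_def ..
  finally have "scale (n * n) (bar a * a) = scale (n * n) 1" .
  then show ?thesis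
    using \<open>n \<noteq> 0\<close> by simp
qed

lemma bar_mult_eq_if_norm_eq_one:
  assumes u: "u \<noteq> 0" "imaginary bar u" and a: "bar a * a = 1"
  shows "\<exists>b. b \<noteq> 0 \<and> bar b * a = b"
proof (cases "1 + a = 0")
  case True
  then have "a = - 1"
    by (simp add: add_eq_0_iff)
  moreover have "bar u = - u"
    using u by (simp add: imaginary_def conj_trace_def add_eq_0_iff)
  ultimately have "bar u * a = u"
    by (simp add: mult_minus_one)
  then show ?thesis
    using u by blast
next
  case False
  \<comment> \<open>Since 1 is a scalar, the product distributes to \<open>a + bar a * a\<close>,
    which is \<open>a + 1\<close>.\<close>
  have "bar (1 + a) * a = (emb scale 1 + bar a) * a"
    by (simp only: bar.add bar_one emb_one)
  also have "\<dots> = 1 + a"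
    unfolding emb_add_mult by (simp add: a add.commute)
  finally show ?thesis
    using False by blast
qed

end

theorem theorem1:
  fixes scale :: "'k::field \<Rightarrow> 'a::{ab_group_add, times, one} \<Rightarrow> 'a"
    and bar :: "'a \<Rightarrow> 'a"
    and a :: 'a
  assumes "k_algebra scale"
    and "weak_distributive scale"
    and "left_alternative TYPE('a)"
    and "conjugation scale bar"
    and "k_valued scale (conj_trace bar)"
    and "k_valued scale (conj_norm bar)"
    and "anisotropic (conj_norm bar)"
    and "\<exists>u. u \<noteq> 0 \<and> imaginary bar u"
  shows "conj_norm bar a = 1 \<longleftrightarrow> (\<exists>b. b \<noteq> 0 \<and> bar b * a = b)"
proof -
  interpret conj_algebra scale bar
    using assms(1-6) by (simp add: conj_algebra_def conj_algebra_axioms_def)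
  show ?thesis
    unfolding conj_norm_def
    using norm_eq_one_if_bar_mult_eq[OF assms(7)] bar_mult_eq_if_norm_eq_one assms(8)
    by blast
qed

end
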